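(* Let $\tilde m=(\tilde m(n))_{n\ge 0}$ be a sequence of positive real numbers with $\tilde m(0)=1$ that preserves summability. Let $m=(m(n))_{n\ge 0}$ be a sequence of positive real numbers with $m(0)=1$ such that for every $k>0$ there exist $A_k,B_k>0$ satisfying $$|m(n)-\tilde m(n)|\le \frac{A_kB_k^n}{(n!)^{1/k}}\quad\text{for every } n\in\mathbb{N}_0 .$$ Then $m$ also preserves summability.
   Context: Let $\mathbb{E}$ be a complex Banach space with norm $\|\cdot\|_{\mathbb{E}}$, and $\mathbb{E}[[t]]$ the space of formal power series with coefficients in $\mathbb{E}$. For a direction $d\in\mathbb{R}$ and $\alpha,r>0$ put $S_d(\alpha)=\{\rho e^{i\phi}:\rho>0,\ \phi\in(d-\alpha/2,d+\alpha/2)\}$, $D_r=\{z\in\mathbb{C}:|z|<r\}$, and let $\hat S_d(\alpha,r)=S_d(\alpha)\cup D_r$ (a disc-sector in direction $d$, written $\hat S_d$ when $\alpha,r$ are not essential). For $k>0$, $\mathcal{O}^k(\hat S_d(\alpha,r),\mathbb{E})$ is the set of holomorphic $f:\hat S_d(\alpha,r)\to\mathbb{E}$ such that for all $\tilde\alpha\in(0,\alpha)$, $\tilde r\in(0,r)$ there are $A,B>0$ with $\|f(t)\|_{\mathbb{E}}<Ae^{B|t|^k}$ for all $t\in\hat S_d(\tilde\alpha,\tilde r)$. For a power series, membership in this set means that it converges near $0$ and its sum extends analytically to such a function. For a sequence $m$ of positive numbers, the $m$-Borel operator $\mathcal{B}_m:\mathbb{E}[[t]]\to\mathbb{E}[[t]]$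 is $\mathcal{B}_m(\sum_{n\ge0} a_nt^n)=\sum_{n\ge0}\frac{a_n}{m(n)}t^n$. Put $\Gamma_{1/k}=(\Gamma(1+n/k))_{n\ge0}$. A series $\hat u\in\mathbb{E}[[t]]$ is $k$-summable in direction $d$ (written $\hat u\in\mathbb{E}\{t\}_{k,d}$) if there is a disc-sector $\hat S_d$ in direction $d$ with $\mathcal{B}_{\Gamma_{1/k}}\hat u\in\mathcal{O}^k(\hat S_d,\mathbb{E})$. A sequence $m$ of positive numbers preserves summability if for every $k>0$, $d\in\mathbb{R}$ and $\hat u\in\mathbb{E}[[t]]$: $\hat u\in\mathbb{E}\{t\}_{k,d}$ if and only if $\mathcal{B}_m\hat u\in\mathbb{E}\{t\}_{k,d}$. *)

theory Defs
  imports "HOL-Analysis.Analysis"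
begin

class complex_normed_vector = real_normed_vector +
  fixes scaleC :: "complex \<Rightarrow> 'a \<Rightarrow> 'a"  (infixr \<open>*\<^sub>C\<close> 75)
  assumes scaleC_add_right: "a *\<^sub>C (x + y) = a *\<^sub>C x + a *\<^sub>C y"
    and scaleC_add_left: "(a + b) *\<^sub>C x = a *\<^sub>C x + b *\<^sub>C x"
    and scaleC_scaleC: "a *\<^sub>C (b *\<^sub>C x) = (a * b) *\<^sub>C x"
    and scaleR_scaleC: "r *\<^sub>R x = complex_of_real r *\<^sub>C x"
    and norm_scaleC: "norm (a *\<^sub>C x) = cmod a * norm x"

class cbanach = complex_normed_vector + complete_space

subclass (in cbanach) banach ..

instantiation complex :: cbanach
begin

definition scaleC_complex :: "complex \<Rightarrow> complex \<Rightarrow> complex"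
  where "scaleC_complex a x = a * x"

instance
  by standard (simp_all add: scaleC_complex_def algebra_simps norm_mult scaleR_conv_of_real)

end

(* The library's holomorphic_on covers only functions with values in the field itself;
   this is the same notion for values in a complex Banach space. *)
definition cholomorphic_on :: "(complex \<Rightarrow> 'e::cbanach) \<Rightarrow> complex set \<Rightarrow> bool"
    (infixl \<open>(cholomorphic'_on)\<close> 50)
  where "f cholomorphic_on S \<longleftrightarrow>
    (\<forall>z\<in>S. \<exists>D. (f has_derivative (\<lambda>h. h *\<^sub>C D)) (at z within S))"

definition sector :: "real \<Rightarrow> real \<Rightarrow> complex set"
  where "sector d \<alpha> = {rcis \<rho> \<phi> |\<rho> \<phi>. \<rho> > 0 \<and> \<phi> \<in> {d - \<alpha> / 2<..<d + \<alpha> / 2}}"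

definition disc_sector :: "real \<Rightarrow> real \<Rightarrow> real \<Rightarrow> complex set"
  where "disc_sector d \<alpha> r = sector d \<alpha> \<union> ball 0 r"

(* Functions are total; only the values on disc_sector d \<alpha> r matter. *)
definition holo_growth :: "real \<Rightarrow> real \<Rightarrow> real \<Rightarrow> real \<Rightarrow> (complex \<Rightarrow> 'e::cbanach) set"
  where "holo_growth k d \<alpha> r = {f. f cholomorphic_on disc_sector d \<alpha> r \<and>
    (\<forall>\<alpha>'\<in>{0<..<\<alpha>}. \<forall>r'\<in>{0<..<r}. \<exists>A>0. \<exists>B>0.
       \<forall>t\<in>disc_sector d \<alpha>' r'. norm (f t) < A * exp (B * cmod t powr k))}"

definition fps_in_holo_growth :: "real \<Rightarrow> real \<Rightarrow> real \<Rightarrow> real \<Rightarrow> 'e::cbanach fps \<Rightarrow> bool"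
  where "fps_in_holo_growth k d \<alpha> r u \<longleftrightarrow>
    (\<exists>f\<in>holo_growth k d \<alpha> r. \<forall>\<^sub>F z in nhds 0. (\<lambda>n. z ^ n *\<^sub>C fps_nth u n) sums f z)"

definition borel_op :: "(nat \<Rightarrow> real) \<Rightarrow> 'e::cbanach fps \<Rightarrow> 'e fps"
  where "borel_op m u = Abs_fps (\<lambda>n. fps_nth u n /\<^sub>R m n)"

definition summable_dir :: "real \<Rightarrow> real \<Rightarrow> 'e::cbanach fps set"
  where "summable_dir k d = {u. \<exists>\<alpha>>0. \<exists>r>0.
    fps_in_holo_growth k d \<alpha> r (borel_op (\<lambda>n. Gamma (1 + real n / k)) u)}"

(* The coefficient space is a parameter of the notion: it is fixed throughout, and the
   type argument records which one is meant. *)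
definition preserves_summability :: "'e::cbanach itself \<Rightarrow> (nat \<Rightarrow> real) \<Rightarrow> bool"
  where "preserves_summability TYPE('e) m \<longleftrightarrow>
    (\<forall>k>0. \<forall>d. \<forall>u::'e fps. u \<in> summable_dir k d \<longleftrightarrow> borel_op m u \<in> summable_dir k d)"

end

theory Submission
  imports Defs
begin

text \<open>
  Testing summability in direction \<open>\<pi>\<close> on the series with coefficients \<open>\<Gamma>(1 + n/k)\<close>, whose Borel
  transform is \<open>1/(1 - t)\<close>, shows that a sequence preserving summability is geometrically bounded
  from above and from below. The sequence \<open>m\<close> inherits both bounds, so \<open>1/m - 1/m'\<close> is as small as
  \<open>m - m'\<close>. If \<open>u\<close> or its \<open>m\<close>-Borel transform is summable, the coefficients \<open>u(n)/\<Gamma>(1 + n/k)\<close> are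
  geometrically bounded, and the difference of the two transforms of \<open>u\<close> has an entire Borel
  transform of exponential growth of order \<open>k\<close>, which does not affect summability.
\<close>

section \<open>Complex scalar multiplication and vector-valued holomorphy\<close>

lemma bounded_bilinear_scaleC: "bounded_bilinear (scaleC :: complex \<Rightarrow> 'e::cbanach \<Rightarrow> 'e)"
proof
  fix r :: real and a :: complex and b :: 'e
  show "(r *\<^sub>R a) *\<^sub>C b = r *\<^sub>R (a *\<^sub>C b)"
    by (simp add: scaleR_scaleC[where 'a='e] scaleC_scaleC scaleR_conv_of_real)
  show "a *\<^sub>C (r *\<^sub>R b) = r *\<^sub>R (a *\<^sub>C b)"
    by (simp add: scaleR_scaleC scaleC_scaleC mult.commute)
  show "\<exists>K. \<forall>(a::complex) (b::'e). norm (a *\<^sub>C b) \<le> norm a * norm b * K"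
    by (rule exI[of _ 1]) (simp add: norm_scaleC)
qed (simp_all add: scaleC_add_right scaleC_add_left)

lemma has_derivative_scaleC_left:
  fixes e :: "'e::cbanach"
  assumes "(f has_field_derivative D) (at z within S)"
  shows "((\<lambda>z. f z *\<^sub>C e) has_derivative (\<lambda>h. h *\<^sub>C (D *\<^sub>C e))) (at z within S)"
  using bounded_linear.has_derivative
      [OF bounded_bilinear.bounded_linear_left[OF bounded_bilinear_scaleC, of e]
        assms[unfolded has_field_derivative_def]]
  by (simp add: scaleC_scaleC mult.commute)

lemma cholomorphic_on_subset:
  assumes "f cholomorphic_on S" and "T \<subseteq> S"
  shows "f cholomorphic_on T"
  using assms has_derivative_subset unfolding cholomorphic_on_def by blast

lemma cholomorphic_on_add:
  assumes "f cholomorphic_on S" and "g cholomorphic_on S"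
  shows "(\<lambda>z. f z + g z) cholomorphic_on S"
  unfolding cholomorphic_on_def
proof
  fix z assume "z \<in> S"
  with assms obtain D E where
    "(f has_derivative (\<lambda>h. h *\<^sub>C D)) (at z within S)"
    "(g has_derivative (\<lambda>h. h *\<^sub>C E)) (at z within S)"
    unfolding cholomorphic_on_def by blast
  from has_derivative_add[OF this]
  show "\<exists>D. ((\<lambda>z. f z + g z) has_derivative (\<lambda>h. h *\<^sub>C D)) (at z within S)"
    by (auto simp: scaleC_add_right[symmetric])
qed

section \<open>Geometric bounds on coefficient sequences\<close>

definition geometrically_bounded :: "(nat \<Rightarrow> 'a::real_normed_vector) \<Rightarrow> bool"
  where "geometrically_bounded a \<longleftrightarrow> (\<exists>A>0. \<exists>B>0. \<forall>n. norm (a n) \<le> A * B ^ n)"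

lemma geometrically_boundedI:
  assumes "\<And>n. norm (a n) \<le> A * B ^ n" and "B > 0"
  shows "geometrically_bounded a"
  unfolding geometrically_bounded_def
proof (intro exI conjI allI)
  show "norm (a n) \<le> (\<bar>A\<bar> + 1) * B ^ n" for n
    by (rule order_trans[OF assms(1)]) (use assms(2) in \<open>auto intro!: mult_right_mono\<close>)
qed (use assms(2) in auto)

lemma geometrically_boundedE:
  assumes "geometrically_bounded a"
  obtains A B where "A > 0" and "B > 0" and "\<And>n. norm (a n) \<le> A * B ^ n"
  using assms unfolding geometrically_bounded_def by blast

lemma geometrically_bounded_scaleR:
  assumes "geometrically_bounded c" and "geometrically_bounded a"
  shows "geometrically_bounded (\<lambda>n. c n *\<^sub>R a n)"
proof -
  obtain A B where AB: "A > 0" "B > 0" "\<And>n. norm (c n) \<le> A * B ^ n"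
    using assms(1) geometrically_boundedE by blast
  obtain C D where CD: "C > 0" "D > 0" "\<And>n. norm (a n) \<le> C * D ^ n"
    using assms(2) geometrically_boundedE by blast
  show ?thesis
  proof (rule geometrically_boundedI)
    show "norm (c n *\<^sub>R a n) \<le> (A * C) * (B * D) ^ n" for n
      using mult_mono[OF AB(3)[of n] CD(3)[of n]] AB CD by (simp add: power_mult_distrib ac_simps)
  qed (use AB CD in simp)
qed

text \<open>Convergence at a single point \<open>x > 0\<close> makes the terms there bounded, so the
  coefficients are at most a constant times \<open>(1 / x) ^ n\<close>.\<close>

lemma fps_in_holo_growth_geometrically_bounded:
  assumes "fps_in_holo_growth k d \<alpha> r u"
  shows "geometrically_bounded (fps_nth u)"
proof -
  obtain f where "\<forall>\<^sub>F z in nhds 0. (\<lambda>n. z ^ n *\<^sub>C fps_nth u n) sums f z"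
    using assms unfolding fps_in_holo_growth_def by blast
  then obtain e where e: "e > 0" "\<And>z. dist z 0 < e \<Longrightarrow> (\<lambda>n. z ^ n *\<^sub>C fps_nth u n) sums f z"
    unfolding eventually_nhds_metric by blast
  define x where "x = e / 2"
  have x: "x > 0" using e(1) by (simp add: x_def)
  have "(\<lambda>n. complex_of_real x ^ n *\<^sub>C fps_nth u n) \<longlonglongrightarrow> 0"
    using e(2)[of "complex_of_real x"] e(1)
    by (intro summable_LIMSEQ_zero sums_summable) (simp add: x_def)
  then have "Bseq (\<lambda>n. complex_of_real x ^ n *\<^sub>C fps_nth u n)"
    using convergentI convergent_imp_Bseq by blast
  then obtain K where K: "\<And>n. norm (complex_of_real x ^ n *\<^sub>C fps_nth u n) \<le> K"
    by (auto elim!: BseqE)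
  show ?thesis
  proof (rule geometrically_boundedI)
    show "norm (fps_nth u n) \<le> K * (1 / x) ^ n" for n
      using K[of n] x by (simp add: norm_scaleC norm_power field_simps)
  qed (use x in simp)
qed

section \<open>Entire power series of exponential growth of order \<open>k\<close>\<close>

text \<open>One term of the exponential series at \<open>x powr k\<close> is at most the whole sum;
  taking the power \<open>1 / k\<close> gives the claim.\<close>

lemma power_over_root_fact_le:
  fixes x k :: real
  assumes "k > 0" and "x \<ge> 0"
  shows "x ^ n / fact n powr (1 / k) \<le> exp (x powr k / k)"
proof (cases "x = 0")
  case True
  then show ?thesis by (cases n) auto
next
  case False
  with assms have x: "x > 0" by simp
  have "(x powr k) ^ n / fact n \<le> exp (x powr k)"
    using sum_le_suminf[of "\<lambda>n. (x powr k) ^ n /\<^sub>R fact n" "{n}"] summable_exp_generic[of "x powr k"]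
    by (simp add: exp_def field_simps)
  then have "((x powr k) ^ n / fact n) powr (1 / k) \<le> exp (x powr k) powr (1 / k)"
    using assms(1) by (intro powr_mono2) auto
  moreover have "((x powr k) ^ n / fact n) powr (1 / k) = x ^ n / fact n powr (1 / k)"
    using x assms(1) by (simp add: powr_divide powr_powr flip: powr_realpow)
  moreover have "exp (x powr k) powr (1 / k) = exp (x powr k / k)"
    by (simp add: powr_def)
  ultimately show ?thesis by simp
qed

text \<open>Doubling the radius inside the exponential frees a factor \<open>(1 / 2) ^ n\<close>,
  which turns a bound on single terms into a summable majorant.\<close>

lemma norm_term_le_geometric:
  fixes a :: "nat \<Rightarrow> 'e::cbanach"
  assumes k: "k > 0" and "A > 0" "B > 0"
    and a: "\<And>n. norm (a n) \<le> A * B ^ n / fact n powr (1 / k)" and "R \<ge> 0"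
  shows "R ^ n * norm (a n) \<le> A * exp ((2 * B * R) powr k / k) * (1 / 2) ^ n"
proof -
  have "R ^ n * norm (a n) \<le> R ^ n * (A * B ^ n / fact n powr (1 / k))"
    using assms by (intro mult_left_mono) auto
  also have "\<dots> = A * ((2 * B * R) ^ n / fact n powr (1 / k)) * (1 / 2) ^ n"
    by (simp add: power_mult_distrib power_divide)
  also have "\<dots> \<le> A * exp ((2 * B * R) powr k / k) * (1 / 2) ^ n"
    using assms by (intro mult_right_mono mult_left_mono power_over_root_fact_le) auto
  finally show ?thesis .
qed

text \<open>Termwise differentiation: the Weierstrass test with the majorant at radius
  \<open>R\<close> makes the differentiated series converge uniformly on the open disc.\<close>

lemma power_series_has_derivative:
  fixes a :: "nat \<Rightarrow> 'e::cbanach"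
  assumes summable: "summable (\<lambda>n. real n * R ^ (n - 1) * norm (a n))"
    and g: "\<And>z. cmod z < R \<Longrightarrow> (\<lambda>n. z ^ n *\<^sub>C a n) sums g z"
    and z: "cmod z < R"
  shows "\<exists>D. (g has_derivative (\<lambda>h. h *\<^sub>C D)) (at z)"
proof -
  define b where "b = (\<lambda>n x. (of_nat n * x ^ (n - 1)) *\<^sub>C a n)"
  define G where "G = (\<lambda>x. \<Sum>n. b n x)"
  have R: "R > 0" using z le_less_trans[OF norm_ge_zero] by blast
  have "uniform_limit (ball 0 R) (\<lambda>n x. \<Sum>i<n. b i x) G sequentially"
    unfolding G_def
  proof (rule Weierstrass_m_test[OF _ summable])
    fix n and x :: complex
    assume "x \<in> ball 0 R"
    then show "norm (b n x) \<le> real n * R ^ (n - 1) * norm (a n)"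
      using R by (auto simp: b_def norm_scaleC norm_mult norm_power intro!: mult_mono power_mono)
  qed
  then have lim: "\<forall>\<^sub>F n in sequentially. \<forall>x\<in>ball (0::complex) R. norm ((\<Sum>i<n. b i x) - G x) < e"
    if "e > 0" for e
    using that unfolding uniform_limit_iff dist_norm by blast
  have "\<exists>f. \<forall>x\<in>ball 0 R. (\<lambda>n. x ^ n *\<^sub>C a n) sums f x
      \<and> (f has_derivative (\<lambda>h. h *\<^sub>C G x)) (at x within ball 0 R)"
  proof (rule has_derivative_series)
    show "((\<lambda>x. x ^ n *\<^sub>C a n) has_derivative (\<lambda>h. h *\<^sub>C b n x)) (at x within ball 0 R)"
      for n and x :: complex
      unfolding b_def by (rule has_derivative_scaleC_left) (auto intro!: derivative_eq_intros)
    \<comment> \<open>Uniform convergence is required for the derivatives as linear maps; factoring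
      out \<open>h\<close> reduces it to \<open>lim\<close>.\<close>
    show "\<forall>\<^sub>F n in sequentially. \<forall>x\<in>ball (0::complex) R. \<forall>h.
        norm ((\<Sum>i<n. h *\<^sub>C b i x) - h *\<^sub>C G x) \<le> e * norm h" if "e > 0" for e
      using lim[OF that]
    proof (rule eventually_mono, intro ballI allI)
      fix n and x h :: complex
      assume "\<forall>x\<in>ball 0 R. norm ((\<Sum>i<n. b i x) - G x) < e" and "x \<in> ball 0 R"
      then have *: "norm ((\<Sum>i<n. b i x) - G x) \<le> e" by fastforce
      have "(\<Sum>i<n. h *\<^sub>C b i x) - h *\<^sub>C G x = h *\<^sub>C ((\<Sum>i<n. b i x) - G x)"
        by (simp add: bounded_bilinear.diff_right[OF bounded_bilinear_scaleC]
            bounded_bilinear.sum_right[OF bounded_bilinear_scaleC])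
      then show "norm ((\<Sum>i<n. h *\<^sub>C b i x) - h *\<^sub>C G x) \<le> e * norm h"
        using mult_right_mono[OF *, of "norm h"] by (simp add: norm_scaleC mult.commute)
    qed
    show "(\<lambda>n. z ^ n *\<^sub>C a n) sums g z" by (rule g[OF z])
  qed (use z in auto)
  then obtain f where
    f: "\<And>x. x \<in> ball 0 R \<Longrightarrow> (\<lambda>n. x ^ n *\<^sub>C a n) sums f x"
      "\<And>x. x \<in> ball 0 R \<Longrightarrow> (f has_derivative (\<lambda>h. h *\<^sub>C G x)) (at x within ball 0 R)"
    by blast
  \<comment> \<open>The differentiated series only provides some limit function \<open>f\<close>;
    uniqueness of sums identifies it with \<open>g\<close>.\<close>
  have "f x = g x" if "x \<in> ball 0 R" for x
    using sums_unique2[OF f(1)[OF that]] g that by simp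
  then have "(g has_derivative (\<lambda>h. h *\<^sub>C G z)) (at z within ball 0 R)"
    using has_derivative_transform[OF _ _ f(2)[of z]] z by auto
  then show ?thesis
    using z by (auto simp: at_within_open[of z "ball 0 R"])
qed

text \<open>The geometric majorant sums to twice its leading constant, and that constant already has
  the form of an exponential of order \<open>k\<close> in \<open>cmod z\<close>.\<close>

lemma entire_of_exponential_growth:
  fixes a :: "nat \<Rightarrow> 'e::cbanach"
  assumes k: "k > 0" and A: "A > 0" and B: "B > 0"
    and a: "\<And>n. norm (a n) \<le> A * B ^ n / fact n powr (1 / k)"
  obtains g C D where "g cholomorphic_on UNIV" and "C > 0" and "D > 0"
    and "\<And>z. norm (g z) < C * exp (D * cmod z powr k)"
    and "\<And>z. (\<lambda>n. z ^ n *\<^sub>C a n) sums g z"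
proof -
  define g where "g = (\<lambda>z. \<Sum>n. z ^ n *\<^sub>C a n)"
  define M where "M R = A * exp ((2 * B * R) powr k / k)" for R
  note term_le = norm_term_le_geometric[OF k A B a, folded M_def]
  have norm_le: "norm (z ^ n *\<^sub>C a n) \<le> M (cmod z) * (1 / 2) ^ n" for z n
    using term_le[of "cmod z" n] by (simp add: norm_scaleC norm_power)
  have geometric: "(\<lambda>n. c * (1 / 2) ^ n) sums (2 * c)" for c :: real
    using sums_mult[OF geometric_sums[of "1 / 2 :: real"], of c] by (simp add: mult.commute)
  have g_sums: "(\<lambda>n. z ^ n *\<^sub>C a n) sums g z" for z
    unfolding g_def
    by (intro summable_sums summable_comparison_test'[OF sums_summable[OF geometric] norm_le])
  have "g cholomorphic_on UNIV"
    unfolding cholomorphic_on_def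
  proof
    fix z
    define R where "R = cmod z + 1"
    have R: "R \<ge> 1" by (simp add: R_def)
    have "summable (\<lambda>n. real n * R ^ (n - 1) * norm (a n))"
    proof (rule summable_comparison_test'[OF sums_summable[OF geometric]])
      fix n
      \<comment> \<open>The factor \<open>n\<close> from differentiation is absorbed by
        \<open>2 ^ n\<close>, so the term estimate applies at radius \<open>2 * R\<close>;
        \<open>R \<ge> 1\<close> allows the passage from exponent \<open>n - 1\<close> to
        \<open>n\<close>.\<close>
      have "real n * R ^ (n - 1) * norm (a n) \<le> 2 ^ n * R ^ n * norm (a n)"
        using R by (intro mult_mono power_increasing) auto
      also have "\<dots> \<le> M (2 * R) * (1 / 2) ^ n"
        using term_le[of "2 * R" n] R by (simp add: power_mult_distrib)
      finally show "norm (real n * R ^ (n - 1) * norm (a n)) \<le> M (2 * R) * (1 / 2) ^ n"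
        using R by simp
    qed
    then show "\<exists>D. (g has_derivative (\<lambda>h. h *\<^sub>C D)) (at z)"
      by (rule power_series_has_derivative[OF _ g_sums]) (simp add: R_def)
  qed
  \<comment> \<open>The summand 1 makes the inequality strict, as \<open>holo_growth\<close>
    demands.\<close>
  moreover have "norm (g z) < (2 * A + 1) * exp ((2 * B) powr k / k * cmod z powr k)" for z
  proof -
    have "norm (g z) \<le> (\<Sum>n. M (cmod z) * (1 / 2) ^ n)"
      unfolding g_def by (rule norm_suminf_le[OF norm_le sums_summable[OF geometric]])
    also have "\<dots> = 2 * M (cmod z)"
      using geometric sums_unique by metis
    also have "\<dots> = 2 * A * exp ((2 * B) powr k / k * cmod z powr k)"
      using B by (simp add: M_def powr_mult)
    also have "\<dots> < (2 * A + 1) * exp ((2 * B) powr k / k * cmod z powr k)"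
      by simp
    finally show ?thesis .
  qed
  moreover have "(2 * B) powr k / k > 0" using B k by simp
  ultimately show ?thesis
    using that[of g "2 * A + 1" "(2 * B) powr k / k"] g_sums A by simp
qed

section \<open>Stability of summability under small perturbations of the coefficients\<close>

lemma holo_growth_add_entire:
  assumes f: "f \<in> holo_growth k d \<alpha> r" and g: "g cholomorphic_on UNIV"
    and "C > 0" and "D > 0" and growth: "\<And>z. norm (g z) < C * exp (D * cmod z powr k)"
  shows "(\<lambda>z. f z + g z) \<in> holo_growth k d \<alpha> r"
  unfolding holo_growth_def mem_Collect_eq
proof (intro conjI ballI)
  show "(\<lambda>z. f z + g z) cholomorphic_on disc_sector d \<alpha> r"
    using f g by (auto simp: holo_growth_def intro!: cholomorphic_on_add elim: cholomorphic_on_subset)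
  fix \<alpha>' r' assume "\<alpha>' \<in> {0<..<\<alpha>}" "r' \<in> {0<..<r}"
  with f obtain A B where AB: "A > 0" "B > 0"
    "\<And>t. t \<in> disc_sector d \<alpha>' r' \<Longrightarrow> norm (f t) < A * exp (B * cmod t powr k)"
    unfolding holo_growth_def by blast
  have "norm (f t + g t) < (A + C) * exp ((B + D) * cmod t powr k)"
    if "t \<in> disc_sector d \<alpha>' r'" for t
  proof -
    have "norm (f t + g t) < A * exp (B * cmod t powr k) + C * exp (D * cmod t powr k)"
      using norm_triangle_ineq[of "f t" "g t"] AB(3)[OF that] growth[of t] by linarith
    also have "\<dots> \<le> A * exp ((B + D) * cmod t powr k) + C * exp ((B + D) * cmod t powr k)"
      using AB assms by (intro add_mono mult_left_mono) (auto intro!: mult_right_mono)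
    finally show ?thesis by (simp add: algebra_simps)
  qed
  then show "\<exists>A>0. \<exists>B>0. \<forall>t\<in>disc_sector d \<alpha>' r'.
      norm (f t + g t) < A * exp (B * cmod t powr k)"
    using AB assms by (intro exI[of _ "A + C"] exI[of _ "B + D"] conjI) auto
qed

lemma fps_nth_borel_op [simp]: "fps_nth (borel_op m u) n = fps_nth u n /\<^sub>R m n"
  by (simp add: borel_op_def)

lemma Gamma_pos: "k > 0 \<Longrightarrow> Gamma (1 + real n / k) > 0"
  by (intro Gamma_real_pos add_pos_nonneg) auto

lemma summable_dir_geometrically_bounded:
  assumes "u \<in> summable_dir k d"
  shows "geometrically_bounded (\<lambda>n. fps_nth u n /\<^sub>R Gamma (1 + real n / k))"
proof -
  have "geometrically_bounded (fps_nth (borel_op (\<lambda>n. Gamma (1 + real n / k)) u))"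
    using assms fps_in_holo_growth_geometrically_bounded unfolding summable_dir_def by blast
  also have "fps_nth (borel_op (\<lambda>n. Gamma (1 + real n / k)) u)
      = (\<lambda>n. fps_nth u n /\<^sub>R Gamma (1 + real n / k))"
    by (simp add: fun_eq_iff)
  finally show ?thesis .
qed

text \<open>The Borel transform of \<open>v - u\<close> is entire with growth of order
  \<open>k\<close>. Adding it to the continuation for \<open>u\<close> gives one for
  \<open>v\<close> on the same disc-sector.\<close>

lemma summable_dir_perturb:
  assumes k: "k > 0" and u: "u \<in> summable_dir k d" and "A > 0" "B > 0"
    and le: "\<And>n. norm ((fps_nth v n - fps_nth u n) /\<^sub>R Gamma (1 + real n / k))
      \<le> A * B ^ n / fact n powr (1 / k)"
  shows "v \<in> summable_dir k d"
proof -
  obtain \<alpha> r f where \<alpha>r: "\<alpha> > 0" "r > 0" and f: "f \<in> holo_growth k d \<alpha> r"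
    and f_sums: "\<forall>\<^sub>F z in nhds 0.
      (\<lambda>n. z ^ n *\<^sub>C fps_nth (borel_op (\<lambda>n. Gamma (1 + real n / k)) u) n) sums f z"
    using u unfolding summable_dir_def fps_in_holo_growth_def by blast
  obtain g C D where g: "g cholomorphic_on UNIV" "C > 0" "D > 0"
      "\<And>z. norm (g z) < C * exp (D * cmod z powr k)"
    and g_sums: "\<And>z. (\<lambda>n. z ^ n *\<^sub>C ((fps_nth v n - fps_nth u n) /\<^sub>R Gamma (1 + real n / k))) sums g z"
    by (rule entire_of_exponential_growth[OF k assms(3,4) le]) (rule that)
  have "\<forall>\<^sub>F z in nhds 0.
      (\<lambda>n. z ^ n *\<^sub>C fps_nth (borel_op (\<lambda>n. Gamma (1 + real n / k)) v) n) sums (f z + g z)"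
    using f_sums
  proof (rule eventually_mono)
    fix z
    assume "(\<lambda>n. z ^ n *\<^sub>C fps_nth (borel_op (\<lambda>n. Gamma (1 + real n / k)) u) n) sums f z"
    from sums_add[OF this g_sums[of z]]
    show "(\<lambda>n. z ^ n *\<^sub>C fps_nth (borel_op (\<lambda>n. Gamma (1 + real n / k)) v) n) sums (f z + g z)"
      by (simp add: scaleC_add_right[symmetric] scaleR_diff_right)
  qed
  then have "fps_in_holo_growth k d \<alpha> r (borel_op (\<lambda>n. Gamma (1 + real n / k)) v)"
    unfolding fps_in_holo_growth_def by (rule bexI[OF _ holo_growth_add_entire[OF f g]])
  with \<alpha>r show ?thesis
    unfolding summable_dir_def by blast
qed

section \<open>The test series and the bounds it forces\<close>

text \<open>The sector of opening \<open>pi\<close> in direction \<open>pi\<close> is the open left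
  half-plane, where \<open>Re (1 - t) > 1\<close>; on the disc the reverse triangle inequality
  applies. Hence the region keeps its distance from the pole of \<open>1 / (1 - t)\<close>.\<close>

lemma disc_sector_pi_pi_bound:
  assumes "t \<in> disc_sector pi pi r" and "0 < r" "r < 1"
  shows "1 - r \<le> cmod (1 - t)"
  using assms(1) unfolding disc_sector_def
proof
  assume "t \<in> sector pi pi"
  then obtain \<rho> \<phi> where t: "t = rcis \<rho> \<phi>" "\<rho> > 0" and \<phi>: "pi / 2 < \<phi>" "\<phi> < 3 * pi / 2"
    unfolding sector_def by auto
  have "cos \<phi> = - cos (\<phi> - pi)" by simp
  moreover have "cos (\<phi> - pi) > 0"
    using \<phi> by (intro cos_gt_zero_pi) linarith+
  ultimately have "Re t < 0"
    using t by (simp add: rcis_def mult_pos_neg)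
  then show ?thesis
    using complex_Re_le_cmod[of "1 - t"] assms(2) by simp
next
  assume "t \<in> ball 0 r"
  then show ?thesis
    using norm_triangle_ineq2[of 1 t] by simp
qed

lemma disc_sector_mono:
  "\<alpha>' \<le> \<alpha> \<Longrightarrow> r' \<le> r \<Longrightarrow> disc_sector d \<alpha>' r' \<subseteq> disc_sector d \<alpha> r"
  unfolding disc_sector_def sector_def by fastforce

text \<open>The Borel transform has all coefficients equal to \<open>e\<close>, so its sum is
  \<open>e\<close> times \<open>1 / (1 - t)\<close>. This is bounded by \<open>2 * norm e\<close> on
  the disc-sector of radius \<open>1 / 2\<close>, which avoids the pole.\<close>

lemma Gamma_series_summable_dir:
  fixes e :: "'e::cbanach"
  assumes k: "k > 0"
  shows "Abs_fps (\<lambda>n. Gamma (1 + real n / k) *\<^sub>R e) \<in> summable_dir k pi"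
proof -
  define f where "f = (\<lambda>z. (1 / (1 - z)) *\<^sub>C e)"
  have "f \<in> holo_growth k pi pi (1 / 2)"
    unfolding holo_growth_def mem_Collect_eq
  proof (intro conjI ballI)
    show "f cholomorphic_on disc_sector pi pi (1 / 2)"
      unfolding cholomorphic_on_def
    proof
      fix z assume z: "z \<in> disc_sector pi pi (1 / 2)"
      then have "1 - z \<noteq> 0"
        using disc_sector_pi_pi_bound[OF z] by auto
      then have "((\<lambda>z. 1 / (1 - z)) has_field_derivative 1 / (1 - z)\<^sup>2) (at z within disc_sector pi pi (1 / 2))"
        by (auto intro!: derivative_eq_intros simp: power2_eq_square)
      then show "\<exists>D. (f has_derivative (\<lambda>h. h *\<^sub>C D)) (at z within disc_sector pi pi (1 / 2))"
        unfolding f_def using has_derivative_scaleC_left by blast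
    qed
    fix \<alpha>' r' :: real assume "\<alpha>' \<in> {0<..<pi}" "r' \<in> {0<..<1 / 2}"
    then have sub: "disc_sector pi \<alpha>' r' \<subseteq> disc_sector pi pi (1 / 2)"
      by (intro disc_sector_mono) auto
    have "norm (f t) < (2 * norm e + 1) * exp (1 * cmod t powr k)"
      if "t \<in> disc_sector pi \<alpha>' r'" for t
    proof -
      have "1 / 2 \<le> cmod (1 - t)"
        using disc_sector_pi_pi_bound[of t "1 / 2"] sub that by auto
      then have "norm (f t) \<le> 2 * norm e"
        using mult_right_mono[of "1 / cmod (1 - t)" 2 "norm e"]
        by (simp add: f_def norm_scaleC norm_divide divide_le_eq)
      also have "\<dots> < (2 * norm e + 1) * 1" by simp
      also have "\<dots> \<le> (2 * norm e + 1) * exp (1 * cmod t powr k)"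
        by (intro mult_left_mono) auto
      finally show ?thesis .
    qed
    then show "\<exists>A>0. \<exists>B>0. \<forall>t\<in>disc_sector pi \<alpha>' r'. norm (f t) < A * exp (B * cmod t powr k)"
      by (intro exI[of _ "2 * norm e + 1"] exI[of _ 1] conjI) (auto simp: add_nonneg_pos)
  qed
  moreover have "\<forall>\<^sub>F z in nhds 0. (\<lambda>n. z ^ n *\<^sub>C e) sums f z"
    unfolding eventually_nhds_metric
  proof (intro exI[of _ 1] conjI allI impI)
    fix z :: complex assume "dist z 0 < 1"
    then have "(\<lambda>n. z ^ n) sums (1 / (1 - z))"
      by (intro geometric_sums) simp
    then show "(\<lambda>n. z ^ n *\<^sub>C e) sums f z"
      unfolding f_def
      by (rule bounded_linear.sums[OF bounded_bilinear.bounded_linear_left[OF bounded_bilinear_scaleC]])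
  qed simp
  ultimately have "fps_in_holo_growth k pi pi (1 / 2)
      (borel_op (\<lambda>n. Gamma (1 + real n / k)) (Abs_fps (\<lambda>n. Gamma (1 + real n / k) *\<^sub>R e)))"
    using Gamma_pos[OF k] unfolding fps_in_holo_growth_def
    by (auto simp: less_imp_neq[THEN not_sym])
  then show ?thesis
    unfolding summable_dir_def mem_Collect_eq
    by (intro exI[of _ pi] exI[of _ "1 / 2"] conjI) auto
qed

text \<open>The two directions of the equivalence, tested at \<open>k = 1\<close> in direction
  \<open>pi\<close>, give the two bounds, because summability makes the Borel coefficients
  geometrically bounded.\<close>

lemma preserves_summability_geometrically_bounded:
  fixes m :: "nat \<Rightarrow> real" and e :: "'e::cbanach"
  assumes pos: "\<And>n. m n > 0" and m: "preserves_summability TYPE('e) m" and e: "e \<noteq> 0"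
  shows "geometrically_bounded m" and "geometrically_bounded (\<lambda>n. inverse (m n))"
proof -
  define G where "G n = Gamma (1 + real n / 1)" for n
  have G: "G n > 0" for n unfolding G_def by (rule Gamma_pos) simp
  have Gu: "Abs_fps (\<lambda>n. G n *\<^sub>R e) \<in> summable_dir 1 pi"
    unfolding G_def by (rule Gamma_series_summable_dir) simp
  have bdd: "geometrically_bounded (\<lambda>n. fps_nth u n /\<^sub>R G n)"
    if "u \<in> summable_dir 1 pi" for u :: "'e fps"
    unfolding G_def by (rule summable_dir_geometrically_bounded[OF that])
  have iff: "u \<in> summable_dir 1 pi \<longleftrightarrow> borel_op m u \<in> summable_dir 1 pi" for u :: "'e fps"
    using m zero_less_one unfolding preserves_summability_def by blast
  \<comment> \<open>Passing from vector to scalar coefficients costs a division by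
    \<open>norm e\<close>, hence the hypothesis \<open>e \<noteq> 0\<close>.\<close>
  have cancel: "geometrically_bounded c" if c: "geometrically_bounded (\<lambda>n. c n *\<^sub>R e)"
    for c :: "nat \<Rightarrow> real"
  proof -
    obtain A B where AB: "B > 0" "\<And>n. norm (c n *\<^sub>R e) \<le> A * B ^ n"
      using c geometrically_boundedE by blast
    show ?thesis
    proof (rule geometrically_boundedI[OF _ AB(1)])
      show "norm (c n) \<le> A / norm e * B ^ n" for n
        using AB(2)[of n] e by (simp add: field_simps)
    qed
  qed
  have nz: "G n \<noteq> 0" "m n \<noteq> 0" for n
    using G[of n] pos[of n] by auto
  \<comment> \<open>This series is the preimage of the test series; its own Borel coefficients are
    \<open>m n\<close> times \<open>e\<close>.\<close>
  have "borel_op m (Abs_fps (\<lambda>n. (m n * G n) *\<^sub>R e)) = Abs_fps (\<lambda>n. G n *\<^sub>R e)"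
    using nz by (simp add: fps_eq_iff)
  then have "Abs_fps (\<lambda>n. (m n * G n) *\<^sub>R e) \<in> summable_dir 1 pi"
    using Gu iff by metis
  from bdd[OF this] show "geometrically_bounded m"
    using nz by (intro cancel) (simp add: mult.left_commute[of "inverse (G _)"])
  \<comment> \<open>The image of the test series has Borel coefficients \<open>inverse (m n)\<close>
    times \<open>e\<close>.\<close>
  from bdd[OF iffD1[OF iff Gu]]
  show "geometrically_bounded (\<lambda>n. inverse (m n))"
    using nz by (intro cancel) (simp add: mult.left_commute[of "inverse (G _)"])
qed

section \<open>Transfer of the bounds to a nearby sequence\<close>

text \<open>Since \<open>1 / k\<close> ranges over all positive reals, this is decay faster than
  every fixed power of \<open>1 / fact n\<close>.\<close>

definition superfactorially_small :: "(nat \<Rightarrow> real) \<Rightarrow> bool"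
  where "superfactorially_small \<delta> \<longleftrightarrow>
    (\<forall>k>0. \<exists>A>0. \<exists>B>0. \<forall>n. \<bar>\<delta> n\<bar> \<le> A * B ^ n / fact n powr (1 / k))"

lemma superfactorially_smallE:
  assumes "superfactorially_small \<delta>" and "k > 0"
  obtains A B where "A > 0" "B > 0" "\<And>n. \<bar>\<delta> n\<bar> \<le> A * B ^ n / fact n powr (1 / k)"
  using assms unfolding superfactorially_small_def by blast

lemma superfactorially_small_bound:
  assumes "superfactorially_small \<delta>" and c: "geometrically_bounded c" and "k > 0"
  obtains A B where "A > 0" "B > 0" "\<And>n. \<bar>\<delta> n\<bar> * norm (c n) \<le> A * B ^ n / fact n powr (1 / k)"
proof -
  obtain A B where AB: "A > 0" "B > 0" "\<And>n. \<bar>\<delta> n\<bar> \<le> A * B ^ n / fact n powr (1 / k)"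
    using superfactorially_smallE[OF assms(1,3)] by blast
  obtain C D where CD: "C > 0" "D > 0" "\<And>n. norm (c n) \<le> C * D ^ n"
    using geometrically_boundedE[OF c] by blast
  have "\<bar>\<delta> n\<bar> * norm (c n) \<le> (A * C) * (B * D) ^ n / fact n powr (1 / k)" for n
    using mult_mono[OF AB(3)[of n] CD(3)[of n]] AB CD
    by (simp add: power_mult_distrib ac_simps)
  with AB CD show ?thesis by (intro that[of "A * C" "B * D"]) auto
qed

text \<open>The case \<open>k = 1\<close> already bounds the difference geometrically; the base
  \<open>B + D\<close> dominates both contributions.\<close>

lemma geometrically_bounded_perturb:
  assumes small: "superfactorially_small (\<lambda>n. m n - m' n)" and m': "geometrically_bounded m'"
  shows "geometrically_bounded m"
proof -
  obtain A B where AB: "A > 0" "B > 0" "\<And>n. \<bar>m n - m' n\<bar> \<le> A * B ^ n / fact n powr (1 / 1)"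
    using superfactorially_smallE[OF small, of 1] by auto
  obtain C D where CD: "C > 0" "D > 0" "\<And>n. norm (m' n) \<le> C * D ^ n"
    using geometrically_boundedE[OF m'] by blast
  show ?thesis
  proof (rule geometrically_boundedI)
    fix n
    have "\<bar>m n - m' n\<bar> \<le> A * B ^ n"
      using AB(1,2) by (intro order_trans[OF AB(3)]) (simp add: divide_le_eq)
    also have "\<dots> \<le> A * (B + D) ^ n"
      using AB CD by (intro mult_left_mono power_mono) auto
    finally have 1: "\<bar>m n - m' n\<bar> \<le> A * (B + D) ^ n" .
    have "norm (m' n) \<le> C * (B + D) ^ n"
      using AB CD by (intro order_trans[OF CD(3)] mult_left_mono power_mono) auto
    with 1 show "norm (m n) \<le> (A + C) * (B + D) ^ n"
      unfolding distrib_right real_norm_def by linarith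
  qed (use AB CD in simp)
qed

text \<open>As \<open>1 / m'\<close> grows at most geometrically, the relative error
  \<open>(m - m') / m'\<close> tends to 0. So \<open>m' \<le> 2 * m\<close> eventually,
  \<open>m' / m\<close> is bounded, and \<open>1 / m\<close> is the product of \<open>m' / m\<close>
  and \<open>1 / m'\<close>.\<close>

lemma geometrically_bounded_inverse_perturb:
  assumes small: "superfactorially_small (\<lambda>n. m n - m' n)"
    and m': "geometrically_bounded (\<lambda>n. inverse (m' n))"
    and pos': "\<And>n. m' n > 0" and pos: "\<And>n. m n > 0"
  shows "geometrically_bounded (\<lambda>n. inverse (m n))"
proof -
  obtain A B where AB: "A > 0" "B > 0" "\<And>n. \<bar>m n - m' n\<bar> * norm (inverse (m' n)) \<le> A * B ^ n / fact n powr (1 / 1)"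
    using superfactorially_small_bound[OF small m', of 1] by auto
  have "(\<lambda>n. A * (B ^ n / fact n)) \<longlonglongrightarrow> 0"
    using tendsto_mult_right_zero[OF summable_LIMSEQ_zero[OF summable_exp[of B]], of A]
    by (simp add: field_simps)
  then have "\<forall>\<^sub>F n in sequentially. A * (B ^ n / fact n) < 1 / 2"
    by (rule order_tendstoD) simp
  then have "\<forall>\<^sub>F n in sequentially. m' n / m n \<le> 2"
  proof (rule eventually_mono)
    fix n assume lt: "A * (B ^ n / fact n) < 1 / 2"
    have "\<bar>m n - m' n\<bar> * inverse (m' n) \<le> A * (B ^ n / fact n)"
      using AB(3)[of n] pos'[of n] by simp
    then have "\<bar>m n - m' n\<bar> * inverse (m' n) < 1 / 2"
      using lt by (rule le_less_trans)
    then have "\<bar>m n - m' n\<bar> < m' n / 2"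
      using pos'[of n] by (simp add: field_simps)
    then have "m' n \<le> 2 * m n" by linarith
    then show "m' n / m n \<le> 2"
      using pos[of n] by (simp add: pos_divide_le_eq)
  qed
  \<comment> \<open>An eventual bound suffices, since finitely many initial terms are always
    bounded.\<close>
  then have "Bseq (\<lambda>n. m' n / m n)"
    using pos pos' by (intro BfunI) (auto elim!: eventually_mono simp: less_imp_le)
  then obtain K where K: "K > 0" "\<And>n. norm (m' n / m n) \<le> K"
    by (auto elim!: BseqE)
  have "geometrically_bounded (\<lambda>n. m' n / m n)"
    using K by (intro geometrically_boundedI[of _ K 1]) auto
  from geometrically_bounded_scaleR[OF this m'] show ?thesis
    using pos' by (simp add: field_simps less_imp_neq[THEN not_sym])
qed

section \<open>Preservation of summability by the perturbed sequence\<close>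

theorem theorem3:
  fixes m m' :: "nat \<Rightarrow> real"
  assumes "\<And>n. m' n > 0" and "m' 0 = 1"
    and "preserves_summability TYPE('e::cbanach) m'"
    and "\<And>n. m n > 0" and "m 0 = 1"
    and "\<And>k::real. k > 0 \<Longrightarrow>
      \<exists>A>0. \<exists>B>0. \<forall>n. \<bar>m n - m' n\<bar> \<le> A * B ^ n / (fact n) powr (1 / k)"
  shows "preserves_summability TYPE('e) m"
proof (cases "\<exists>e::'e. e \<noteq> 0")
  \<comment> \<open>The zero space has no test vector, but there every series is 0 and all Borel
    operators are the identity.\<close>
  case False
  then have "borel_op c u = u" for c and u :: "'e fps"
    by (metis (full_types) fps_ext)
  then show ?thesis
    unfolding preserves_summability_def by simp
next
  case True
  then obtain e :: 'e where e: "e \<noteq> 0" by blast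
  have small: "superfactorially_small (\<lambda>n. m n - m' n)"
    using assms(6) unfolding superfactorially_small_def by blast
  note m'_bdd = preserves_summability_geometrically_bounded[OF assms(1,3) e]
  have m_bdd: "geometrically_bounded m"
    by (rule geometrically_bounded_perturb[OF small m'_bdd(1)])
  have inv_m_bdd: "geometrically_bounded (\<lambda>n. inverse (m n))"
    by (rule geometrically_bounded_inverse_perturb[OF small m'_bdd(2) assms(1,4)])
  \<comment> \<open>The bound on the Borel coefficients of \<open>u\<close> is what makes the two
    transforms differ by a small perturbation.\<close>
  have transfer: "borel_op m u \<in> summable_dir k d \<longleftrightarrow> borel_op m' u \<in> summable_dir k d"
    if k: "k > 0" and u: "geometrically_bounded (\<lambda>n. fps_nth u n /\<^sub>R Gamma (1 + real n / k))"
    for k d and u :: "'e fps"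
  proof -
    \<comment> \<open>As \<open>1 / m' - 1 / m = (m - m') / (m * m')\<close>, the sequence
      \<open>c\<close> collects everything except the small factor \<open>m - m'\<close>.\<close>
    define c where "c n = inverse (m n) *\<^sub>R inverse (m' n) *\<^sub>R (fps_nth u n /\<^sub>R Gamma (1 + real n / k))" for n
    have "geometrically_bounded c"
      unfolding c_def by (intro geometrically_bounded_scaleR inv_m_bdd m'_bdd u)
    then obtain A B where AB: "A > 0" "B > 0"
      "\<And>n. \<bar>m n - m' n\<bar> * norm (c n) \<le> A * B ^ n / fact n powr (1 / k)"
      using superfactorially_small_bound[OF small _ k] by metis
    have diff: "(fps_nth (borel_op m' u) n - fps_nth (borel_op m u) n) /\<^sub>R Gamma (1 + real n / k)
        = (m n - m' n) *\<^sub>R c n" for n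
    proof -
      have "inverse (m' n) - inverse (m n) = (m n - m' n) * (inverse (m n) * inverse (m' n))"
        using assms(1)[of n] assms(4)[of n] by (simp add: field_simps)
      then show ?thesis
        by (simp add: c_def scaleR_diff_left[symmetric] mult.commute mult.left_commute)
    qed
    have 1: "norm ((fps_nth (borel_op m' u) n - fps_nth (borel_op m u) n) /\<^sub>R Gamma (1 + real n / k))
        \<le> A * B ^ n / fact n powr (1 / k)" for n
      using AB(3)[of n] unfolding diff by simp
    have 2: "norm ((fps_nth (borel_op m u) n - fps_nth (borel_op m' u) n) /\<^sub>R Gamma (1 + real n / k))
        \<le> A * B ^ n / fact n powr (1 / k)" for n
      using 1[of n] by (simp add: norm_minus_commute)
    show ?thesis
      using summable_dir_perturb[OF k _ AB(1,2) 1] summable_dir_perturb[OF k _ AB(1,2) 2] by blast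
  qed
  show ?thesis
    unfolding preserves_summability_def
  proof (intro allI impI)
    fix k d :: real and u :: "'e fps" assume k: "k > 0"
    have "u \<in> summable_dir k d \<longleftrightarrow> borel_op m' u \<in> summable_dir k d"
      using assms(3) k unfolding preserves_summability_def by blast
    \<comment> \<open>If \<open>u\<close> is summable, the premise of \<open>transfer\<close> is
      immediate. If only \<open>borel_op m u\<close> is known to be summable, multiplying its Borel
      coefficients by the geometrically bounded \<open>m\<close> recovers those of
      \<open>u\<close>.\<close>
    moreover have "geometrically_bounded (\<lambda>n. fps_nth u n /\<^sub>R Gamma (1 + real n / k))"
      if "borel_op m u \<in> summable_dir k d"
      using geometrically_bounded_scaleR[OF m_bdd summable_dir_geometrically_bounded[OF that]]
        assms(4) by (simp add: less_imp_neq[THEN not_sym] mult.left_commute[of "m _"])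
    ultimately show "u \<in> summable_dir k d \<longleftrightarrow> borel_op m u \<in> summable_dir k d"
      using transfer[OF k] summable_dir_geometrically_bounded by metis
  qed
qed

end
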